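(* Let $n\geq 1$ be an integer, let $a<b$ be real numbers, let $N,N'\subseteq\{0,1,2,\dots,n\}$, and let real numbers $u_i$ ($i\in N$) and $w_j$ ($j\in N'$) be given. Put $$\mathcal{M}_{N,N'}=\{u\in C^n[a,b] : u^{(i)}(a)=u_i \text{ for all } i\in N,\ u^{(j)}(b)=w_j \text{ for all } j\in N'\}.$$ Let $f=f(x_1,\dots,x_{n+2})$ be a real-valued function defined on $[a,b]\times\mathbb{R}^{n+1}$ with continuous second partial derivatives with respect to all its variables, and define the functional $F$ on $\mathcal{M}_{N,N'}$ by $$F(u)=\int_a^b f(t,u(t),u'(t),\dots,u^{(n)}(t))\,dt .$$ Let $u_0\in\mathcal{M}_{N,N'}$ be a local extremum of $F$ with respect to $\mathcal{M}_{N,N'}$, and let $t_0\in(a,b)$ be such that $$\frac{\partial^2 f}{\partial x_{n+2}^2}\bigl(t_0,u_0(t_0),u_0'(t_0),\dots,u_0^{(n)}(t_0)\bigr)\neq 0 .$$ Then there exists $\delta>0$ such that $u_0\in C^{n+1}(t_0-\delta,t_0+\delta)$.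
   Context: $C^n[a,b]$ is the space of $n$ times continuously differentiable real functions on $[a,b]$ with norm $\|u\|_{C^n[a,b]}=\sum_{i=0}^n\|u^{(i)}\|_\infty$. That $u_0\in\mathcal{M}_{N,N'}$ is a local extremum of $F$ with respect to $\mathcal{M}_{N,N'}$ means that there is $\varepsilon>0$ such that either $F(u)\geq F(u_0)$ for all $u\in\mathcal{M}_{N,N'}$ with $\|u-u_0\|_{C^n[a,b]}<\varepsilon$ (local minimum), or $F(u)\leq F(u_0)$ for all such $u$ (local maximum). *)

theory Defs
  imports "HOL-Analysis.Analysis"
begin

text \<open>
  A function on a set \<open>S\<close> of reals is represented by a total function of which only the values
  on \<open>S\<close> matter. All derivatives are taken within \<open>S\<close>; at an endpoint of a closed interval they
  are therefore the usual one-sided derivatives.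
\<close>

primrec nth_deriv_on :: "real set \<Rightarrow> nat \<Rightarrow> (real \<Rightarrow> real) \<Rightarrow> real \<Rightarrow> real" where
  "nth_deriv_on S 0 u = u"
| "nth_deriv_on S (Suc k) u = (\<lambda>t. vector_derivative (nth_deriv_on S k u) (at t within S))"

definition C_space :: "nat \<Rightarrow> real set \<Rightarrow> (real \<Rightarrow> real) set" where
  "C_space n S = {u. (\<forall>k<n. nth_deriv_on S k u differentiable_on S)
                    \<and> continuous_on S (nth_deriv_on S n u)}"

definition C_norm :: "nat \<Rightarrow> real \<Rightarrow> real \<Rightarrow> (real \<Rightarrow> real) \<Rightarrow> real" where
  "C_norm n a b u = (\<Sum>i\<le>n. SUP t\<in>{a..b}. \<bar>nth_deriv_on {a..b} i u t\<bar>)"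

definition admissible ::
  "nat \<Rightarrow> real \<Rightarrow> real \<Rightarrow> nat set \<Rightarrow> nat set \<Rightarrow> (nat \<Rightarrow> real) \<Rightarrow> (nat \<Rightarrow> real) \<Rightarrow> (real \<Rightarrow> real) set" where
  "admissible n a b N N' u_bd w_bd =
     {u \<in> C_space n {a..b}. (\<forall>i\<in>N. nth_deriv_on {a..b} i u a = u_bd i)
                          \<and> (\<forall>j\<in>N'. nth_deriv_on {a..b} j u b = w_bd j)}"

text \<open>
  Points of \<open>m\<close>-dimensional Euclidean space are sequences vanishing from index \<open>m\<close> on, as in
  \<^const>\<open>Euclidean_space\<close>. Coordinates are counted from 0, so the variable
  \<open>x\<^sub>k\<close> of the integrand is the coordinate \<open>k - 1\<close>.
\<close>

definition integrand_domain :: "nat \<Rightarrow> real \<Rightarrow> real \<Rightarrow> (nat \<Rightarrow> real) set" where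
  "integrand_domain n a b = {x \<in> topspace (Euclidean_space (n + 2)). x 0 \<in> {a..b}}"

definition coord_slice :: "(nat \<Rightarrow> real) set \<Rightarrow> nat \<Rightarrow> (nat \<Rightarrow> real) \<Rightarrow> real set" where
  "coord_slice D k x = {s. x(k := s) \<in> D}"

definition partial_differentiable_on ::
  "(nat \<Rightarrow> real) set \<Rightarrow> nat \<Rightarrow> ((nat \<Rightarrow> real) \<Rightarrow> real) \<Rightarrow> bool" where
  "partial_differentiable_on D k g \<longleftrightarrow>
     (\<forall>x\<in>D. (\<lambda>s. g (x(k := s))) differentiable (at (x k) within coord_slice D k x))"

definition partial_deriv ::
  "(nat \<Rightarrow> real) set \<Rightarrow> nat \<Rightarrow> ((nat \<Rightarrow> real) \<Rightarrow> real) \<Rightarrow> (nat \<Rightarrow> real) \<Rightarrow> real" where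
  "partial_deriv D k g x = vector_derivative (\<lambda>s. g (x(k := s))) (at (x k) within coord_slice D k x)"

text \<open>
  The topology on \<^typ>\<open>nat \<Rightarrow> real\<close> underlying \<^const>\<open>continuous_on\<close> is the product topology; on
  sequences vanishing from a fixed index on it is the Euclidean one.
\<close>

definition continuous_second_partials ::
  "nat \<Rightarrow> (nat \<Rightarrow> real) set \<Rightarrow> ((nat \<Rightarrow> real) \<Rightarrow> real) \<Rightarrow> bool" where
  "continuous_second_partials m D g \<longleftrightarrow>
     (\<forall>i<m. partial_differentiable_on D i g
          \<and> (\<forall>j<m. partial_differentiable_on D j (partial_deriv D i g)
                 \<and> continuous_on D (partial_deriv D j (partial_deriv D i g))))"

text \<open>The point \<open>(t, u(t), u'(t), \<dots>)\<close> with derivatives up to order \<open>n\<close>.\<close>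

definition jet :: "nat \<Rightarrow> real \<Rightarrow> real \<Rightarrow> (real \<Rightarrow> real) \<Rightarrow> real \<Rightarrow> nat \<Rightarrow> real" where
  "jet n a b u t =
     (\<lambda>k. if k = 0 then t else if k \<le> n + 1 then nth_deriv_on {a..b} (k - 1) u t else 0)"

definition functional ::
  "nat \<Rightarrow> real \<Rightarrow> real \<Rightarrow> ((nat \<Rightarrow> real) \<Rightarrow> real) \<Rightarrow> (real \<Rightarrow> real) \<Rightarrow> real" where
  "functional n a b f u = integral {a..b} (\<lambda>t. f (jet n a b u t))"

definition local_extremum ::
  "nat \<Rightarrow> real \<Rightarrow> real \<Rightarrow> ((real \<Rightarrow> real) \<Rightarrow> real) \<Rightarrow> (real \<Rightarrow> real) set \<Rightarrow> (real \<Rightarrow> real) \<Rightarrow> bool" where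
  "local_extremum n a b F M u0 \<longleftrightarrow> u0 \<in> M \<and>
     (\<exists>\<epsilon>>0. (\<forall>u\<in>M. C_norm n a b (\<lambda>t. u t - u0 t) < \<epsilon> \<longrightarrow> F u \<ge> F u0)
           \<or> (\<forall>u\<in>M. C_norm n a b (\<lambda>t. u t - u0 t) < \<epsilon> \<longrightarrow> F u \<le> F u0))"

end

theory Submission
  imports Defs
begin

text \<open>
  Write \<open>f\<^sub>k\<close> for the partial derivative of the integrand with respect to the \<open>k\<close>-th derivative of
  the unknown function, evaluated along the extremal. Adding multiples of a test function \<open>h\<close>, that
  is, of a function whose derivatives up to order \<open>n\<close> vanish at both ends, respects every choice
  of boundary conditions. So the first variation \<open>\<integral> \<Sum>\<^sub>k f\<^sub>k h\<^sub>k\<close>, where \<open>h\<^sub>k\<close> denotes the \<open>k\<close>-th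
  derivative of \<open>h\<close>, is zero for all of them (\<open>first_variation_vanishes\<close>).

  The lemma of du Bois-Reymond for higher order (\<open>du_Bois_Reymond\<close>) then says that \<open>f\<^sub>n\<close> is
  continuously differentiable, although the extremal itself is only of class \<open>n\<close>. The
  classical proof integrates by parts \<open>n\<close> times and shows that a certain combination of iterated
  primitives is a polynomial of degree less than \<open>n\<close>. Here the order is lowered by one at a time
  instead: the lowest coefficient is integrated by parts into the next one, at the price of a
  constant that acts as the Lagrange multiplier of the side condition \<open>\<integral> h' = 0\<close>. So neither
  polynomials nor test functions with prescribed moments enter.

  Finally \<open>f\<^sub>n\<close> is a continuously differentiable function of \<open>t\<close> and of the derivatives of the
  extremal up to order \<open>n\<close>. Its composite with these is differentiable, the derivatives of order
  below \<open>n\<close> are differentiable, and near \<open>t\<^sub>0\<close> its partial derivative in the last variable is not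
  zero. So the difference quotients of the \<open>n\<close>-th derivative converge
  (\<open>has_real_derivative_last_coordinate\<close>), and their limit is given by a formula that is
  continuous in \<open>t\<close>.
\<close>

section \<open>Functions with continuous partial derivatives on a box\<close>

lemma tendsto_fun_iff_componentwise:
  fixes X :: "'a \<Rightarrow> 'b \<Rightarrow> 'c::topological_space"
  shows "(X \<longlongrightarrow> x) F \<longleftrightarrow> (\<forall>i. ((\<lambda>j. X j i) \<longlongrightarrow> x i) F)"
  using limitin_componentwise[of "\<lambda>_. euclidean :: 'c topology" "UNIV :: 'b set" X x F]
  by (auto simp: euclidean_product_topology)

lemma tendsto_if_in_closed_segment:
  fixes x :: real
  assumes "(X \<longlongrightarrow> x) F" and "\<forall>\<^sub>F j in F. \<xi> j \<in> closed_segment x (X j)"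
  shows "(\<xi> \<longlongrightarrow> x) F"
proof (rule tendstoI)
  fix e :: real assume "e > 0"
  with assms(1) have "\<forall>\<^sub>F j in F. dist (X j) x < e" by (rule tendstoD)
  with assms(2) show "\<forall>\<^sub>F j in F. dist (\<xi> j) x < e"
  proof eventually_elim
    case (elim j)
    then show ?case
      by (auto simp: closed_segment_eq_real_ivl dist_real_def split: if_splits)
  qed
qed

lemma integrand_domain_iff:
  "x \<in> integrand_domain n a b \<longleftrightarrow> (\<forall>i\<ge>n + 2. x i = 0) \<and> a \<le> x 0 \<and> x 0 \<le> b"
  by (auto simp: integrand_domain_def topspace_Euclidean_space)

lemma has_real_derivative_partial_deriv:
  assumes "partial_differentiable_on D k g" and "x \<in> D"
  shows "((\<lambda>s. g (x(k := s))) has_real_derivative partial_deriv D k g x)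
           (at (x k) within coord_slice D k x)"
  using assms unfolding partial_differentiable_on_def partial_deriv_def
  by (auto simp: has_real_derivative_iff_has_vector_derivative vector_derivative_works[symmetric])

text \<open>
  The domain is a box, so the whole segment from \<open>x\<close> to \<open>x(k := y)\<close> lies in it and the
  one-variable mean value theorem applies, also when \<open>k = 0\<close> and the segment ends on the boundary
  of \<open>{a..b}\<close>.
\<close>

lemma mean_value_one_coordinate:
  assumes "partial_differentiable_on (integrand_domain n a b) k g"
    and "x \<in> integrand_domain n a b" and "x(k := y) \<in> integrand_domain n a b"
  shows "\<exists>c\<in>closed_segment (x k) y. x(k := c) \<in> integrand_domain n a b \<and>
           g (x(k := y)) - g x = partial_deriv (integrand_domain n a b) k g (x(k := c)) * (y - x k)"
proof -
  define D where "D = integrand_domain n a b"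
  define h where "h = (\<lambda>s. g (x(k := s)))"
  have inD: "x(k := s) \<in> D" if "s \<in> closed_segment (x k) y" for s
    using that assms(2,3)
    by (cases "k = 0") (auto simp: D_def integrand_domain_iff closed_segment_eq_real_ivl split: if_splits)
  have der: "(h has_real_derivative partial_deriv D k g (x(k := s))) (at s within T)"
    if "T \<subseteq> closed_segment (x k) y" "s \<in> closed_segment (x k) y" for s T
  proof -
    have "((\<lambda>r. g ((x(k := s))(k := r))) has_real_derivative partial_deriv D k g (x(k := s)))
           (at s within coord_slice D k (x(k := s)))"
      using has_real_derivative_partial_deriv[OF assms(1) inD[OF that(2), unfolded D_def]]
      by (simp add: D_def)
    moreover have "T \<subseteq> coord_slice D k (x(k := s))"
      using inD that by (auto simp: coord_slice_def)
    ultimately show ?thesis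
      unfolding h_def by (auto intro: has_field_derivative_subset)
  qed
  have "\<exists>c\<in>closed_segment (x k) y. h y - h (x k) = partial_deriv D k g (x(k := c)) * (y - x k)"
  proof (cases "x k \<le> y")
    case True
    have "\<exists>c\<in>{x k..y}. h y - h (x k) = (*) (partial_deriv D k g (x(k := c))) (y - x k)"
    proof (rule mvt_very_simple)
      fix s assume "x k \<le> s" "s \<le> y"
      then show "(h has_derivative (*) (partial_deriv D k g (x(k := s)))) (at s within {x k..y})"
        using der[of "{x k..y}" s]
        by (simp add: closed_segment_eq_real_ivl has_field_derivative_def split: if_splits)
    qed (use True in simp)
    then show ?thesis using True by (auto simp: closed_segment_eq_real_ivl)
  next
    case False
    have "\<exists>c\<in>{y..x k}. h (x k) - h y = (*) (partial_deriv D k g (x(k := c))) (x k - y)"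
    proof (rule mvt_very_simple)
      fix s assume "y \<le> s" "s \<le> x k"
      then show "(h has_derivative (*) (partial_deriv D k g (x(k := s)))) (at s within {y..x k})"
        using der[of "{y..x k}" s]
        by (simp add: closed_segment_eq_real_ivl has_field_derivative_def split: if_splits)
    qed (use False in simp)
    then obtain c where "c \<in> {y..x k}" "h (x k) - h y = partial_deriv D k g (x(k := c)) * (x k - y)"
      by blast
    then show ?thesis using False
      by (intro bexI[of _ c]) (auto simp: closed_segment_eq_real_ivl algebra_simps)
  qed
  then show ?thesis using inD by (auto simp: h_def D_def)
qed

text \<open>
  Going from \<open>x\<close> to \<open>y\<close> by changing one coordinate at a time stays in the box, and each step is
  governed by a single partial derivative. The mean value theorem along the straight segment would
  presuppose total differentiability of \<open>g\<close>; this version starts from the partial derivatives.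
\<close>

lemma mean_value_coordinatewise:
  assumes pd: "\<And>k. k < n + 2 \<Longrightarrow> partial_differentiable_on (integrand_domain n a b) k g"
    and x: "x \<in> integrand_domain n a b" and y: "y \<in> integrand_domain n a b"
  shows "\<exists>\<xi>. (\<forall>k<n + 2. \<xi> k \<in> integrand_domain n a b \<and> (\<forall>i. \<xi> k i \<in> closed_segment (x i) (y i)))
           \<and> g y - g x = (\<Sum>k<n + 2. partial_deriv (integrand_domain n a b) k g (\<xi> k) * (y k - x k))"
proof -
  define D where "D = integrand_domain n a b"
  \<comment> \<open>The point \<open>z k\<close> has already moved to \<open>y\<close> in the coordinates below \<open>k\<close>.\<close>
  define z where "z = (\<lambda>k i. if i < k then y i else x i)"
  have zD: "z k \<in> D" for k
    using x y by (auto simp: z_def D_def integrand_domain_iff)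
  have zSuc: "z (Suc k) = (z k)(k := y k)" for k
    by (auto simp: z_def fun_eq_iff less_Suc_eq)
  have "\<exists>c\<in>closed_segment (x k) (y k). (z k)(k := c) \<in> D \<and>
          g (z (Suc k)) - g (z k) = partial_deriv D k g ((z k)(k := c)) * (y k - x k)"
    if "k < n + 2" for k
  proof -
    have "z k k = x k" by (simp add: z_def)
    then show ?thesis
      using mean_value_one_coordinate[OF pd[OF that] zD[of k, unfolded D_def], of "y k"]
        zD[of "Suc k"] that by (simp add: zSuc D_def)
  qed
  then obtain c where c: "\<And>k. k < n + 2 \<Longrightarrow> c k \<in> closed_segment (x k) (y k) \<and> (z k)(k := c k) \<in> D \<and>
      g (z (Suc k)) - g (z k) = partial_deriv D k g ((z k)(k := c k)) * (y k - x k)"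
    by metis
  have "g (z (n + 2)) - g (z 0) = (\<Sum>k<n + 2. g (z (Suc k)) - g (z k))"
    by (rule sum_lessThan_telescope[symmetric])
  moreover have "z 0 = x" by (simp add: z_def)
  moreover have "z (n + 2) = y"
    using x y by (auto simp: z_def fun_eq_iff integrand_domain_iff not_less)
  ultimately have "g y - g x = (\<Sum>k<n + 2. partial_deriv D k g ((z k)(k := c k)) * (y k - x k))"
    using c by simp
  moreover have "((z k)(k := c k)) i \<in> closed_segment (x i) (y i)" if "k < n + 2" for k i
    using c[OF that] by (auto simp: z_def)
  ultimately show ?thesis using c by (intro exI[of _ "\<lambda>k. (z k)(k := c k)"]) (auto simp: D_def)
qed

definition C1_integrand :: "nat \<Rightarrow> real \<Rightarrow> real \<Rightarrow> ((nat \<Rightarrow> real) \<Rightarrow> real) \<Rightarrow> bool" where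
  "C1_integrand n a b g \<longleftrightarrow>
     (\<forall>k<n + 2. partial_differentiable_on (integrand_domain n a b) k g
              \<and> continuous_on (integrand_domain n a b) (partial_deriv (integrand_domain n a b) k g))"

text \<open>
  The form in which continuous partial derivatives are used below. The coefficients \<open>c\<close> are
  values of the partial derivatives at intermediate points, which are squeezed towards \<open>x\<close>. From
  this identity one reads off continuity, the chain rule, and, conversely, differentiability of one
  coordinate of a curve from that of the composite.
\<close>

lemma increment_as_sum:
  assumes g: "C1_integrand n a b g"
    and x: "x \<in> integrand_domain n a b"
    and XD: "\<forall>\<^sub>F j in F. X j \<in> integrand_domain n a b" and X: "(X \<longlongrightarrow> x) F"
  obtains c where
    "\<And>k. k < n + 2 \<Longrightarrow> ((\<lambda>j. c j k) \<longlongrightarrow> partial_deriv (integrand_domain n a b) k g x) F"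
    "\<forall>\<^sub>F j in F. g (X j) - g x = (\<Sum>k<n + 2. c j k * (X j k - x k))"
proof -
  define D where "D = integrand_domain n a b"
  have "\<forall>j. \<exists>\<xi>. X j \<in> D \<longrightarrow> (\<forall>k<n + 2. \<xi> k \<in> D \<and> (\<forall>i. \<xi> k i \<in> closed_segment (x i) (X j i)))
           \<and> g (X j) - g x = (\<Sum>k<n + 2. partial_deriv D k g (\<xi> k) * (X j k - x k))"
    using mean_value_coordinatewise[OF _ x] g by (simp add: D_def C1_integrand_def)
  from choice[OF this] obtain \<xi> where \<xi>: "\<And>j k. X j \<in> D \<Longrightarrow> k < n + 2 \<Longrightarrow> \<xi> j k \<in> D"
    "\<And>j k i. X j \<in> D \<Longrightarrow> k < n + 2 \<Longrightarrow> \<xi> j k i \<in> closed_segment (x i) (X j i)"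
    "\<And>j. X j \<in> D \<Longrightarrow> g (X j) - g x = (\<Sum>k<n + 2. partial_deriv D k g (\<xi> j k) * (X j k - x k))"
    by blast
  have XD: "\<forall>\<^sub>F j in F. X j \<in> D" using XD by (simp add: D_def)
  have "((\<lambda>j. partial_deriv D k g (\<xi> j k)) \<longlongrightarrow> partial_deriv D k g x) F" if k: "k < n + 2" for k
  proof (rule continuous_on_tendsto_compose[where f = "partial_deriv D k g"])
    show "continuous_on D (partial_deriv D k g)"
      using g k by (simp add: C1_integrand_def D_def)
    show "((\<lambda>j. \<xi> j k) \<longlongrightarrow> x) F"
      unfolding tendsto_fun_iff_componentwise
    proof
      fix i
      have "((\<lambda>j. X j i) \<longlongrightarrow> x i) F" using X by (simp add: tendsto_fun_iff_componentwise)
      then show "((\<lambda>j. \<xi> j k i) \<longlongrightarrow> x i) F"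
        by (rule tendsto_if_in_closed_segment) (use XD \<xi>(2)[OF _ k] in \<open>auto elim: eventually_mono\<close>)
    qed
    show "x \<in> D" using x by (simp add: D_def)
    show "\<forall>\<^sub>F j in F. \<xi> j k \<in> D" using XD by eventually_elim (rule \<xi>(1)[OF _ k])
  qed
  moreover have "\<forall>\<^sub>F j in F. g (X j) - g x = (\<Sum>k<n + 2. partial_deriv D k g (\<xi> j k) * (X j k - x k))"
    using XD by eventually_elim (rule \<xi>(3))
  ultimately show ?thesis unfolding D_def by (rule that)
qed

lemma C1_integrand_continuous_on:
  assumes g: "C1_integrand n a b g"
  shows "continuous_on (integrand_domain n a b) g"
  unfolding continuous_on_def
proof
  define D where "D = integrand_domain n a b"
  fix x assume x: "x \<in> integrand_domain n a b"
  have X: "((\<lambda>y. y) \<longlongrightarrow> x) (at x within D)" by (rule tendsto_ident_at)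
  have "\<forall>\<^sub>F y in at x within D. y \<in> D" by (simp add: eventually_at_filter)
  from increment_as_sum[OF g x this[unfolded D_def] X[unfolded D_def]] obtain c where c:
    "\<And>k. k < n + 2 \<Longrightarrow> ((\<lambda>y. c y k) \<longlongrightarrow> partial_deriv D k g x) (at x within D)"
    "\<forall>\<^sub>F y in at x within D. g y - g x = (\<Sum>k<n + 2. c y k * (y k - x k))"
    unfolding D_def by blast
  have "((\<lambda>y. \<Sum>k<n + 2. c y k * (y k - x k)) \<longlongrightarrow>
          (\<Sum>k<n + 2. partial_deriv D k g x * (x k - x k))) (at x within D)"
    using X by (intro tendsto_intros c) (auto simp: tendsto_fun_iff_componentwise)
  then have "((\<lambda>y. \<Sum>k<n + 2. c y k * (y k - x k)) \<longlongrightarrow> 0) (at x within D)" by simp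
  then have "((\<lambda>y. g y - g x) \<longlongrightarrow> 0) (at x within D)"
    by (rule Lim_transform_eventually) (use c(2) in \<open>auto elim: eventually_mono\<close>)
  then show "(g \<longlongrightarrow> g x) (at x within integrand_domain n a b)"
    unfolding D_def by (rule LIM_zero_cancel)
qed

lemma has_real_derivative_along_curve:
  assumes g: "C1_integrand n a b g"
    and X: "\<And>s. X s \<in> integrand_domain n a b"
    and X': "\<And>k. ((\<lambda>s. X s k) has_real_derivative X' k) (at r)"
  shows "((\<lambda>s. g (X s)) has_real_derivative
           (\<Sum>k<n + 2. partial_deriv (integrand_domain n a b) k g (X r) * X' k)) (at r)"
proof -
  define D where "D = integrand_domain n a b"
  have Xr: "(X \<longlongrightarrow> X r) (at r)"
    using DERIV_isCont[OF X'] by (auto simp: tendsto_fun_iff_componentwise isCont_def)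
  obtain c where c: "\<And>k. k < n + 2 \<Longrightarrow> ((\<lambda>s. c s k) \<longlongrightarrow> partial_deriv D k g (X r)) (at r)"
    "\<forall>\<^sub>F s in at r. g (X s) - g (X r) = (\<Sum>k<n + 2. c s k * (X s k - X r k))"
    using increment_as_sum[OF g X always_eventually Xr] X unfolding D_def by blast
  have "((\<lambda>s. \<Sum>k<n + 2. c s k * ((X s k - X r k) / (s - r))) \<longlongrightarrow>
           (\<Sum>k<n + 2. partial_deriv D k g (X r) * X' k)) (at r)"
    using X' by (intro tendsto_intros c) (auto simp: has_field_derivative_iff)
  moreover have "\<forall>\<^sub>F s in at r. (\<Sum>k<n + 2. c s k * ((X s k - X r k) / (s - r))) = (g (X s) - g (X r)) / (s - r)"
    using c(2) by eventually_elim (simp only: sum_divide_distrib times_divide_eq_right)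
  ultimately show ?thesis
    unfolding has_field_derivative_iff D_def by (rule Lim_transform_eventually)
qed

text \<open>
  The part of the implicit function theorem that concerns regularity. The last coordinate of the
  curve is already given as a continuous function, and only its difference quotient is at issue: in
  the identity of \<open>increment_as_sum\<close> the coefficient of its increment tends to a nonzero number, and all other
  difference quotients converge.
\<close>

lemma has_real_derivative_last_coordinate:
  assumes g: "C1_integrand n a b g"
    and XD: "\<forall>\<^sub>F s in at t. X s \<in> integrand_domain n a b" "X t \<in> integrand_domain n a b"
    and X: "(X \<longlongrightarrow> X t) (at t)"
    and X': "\<And>k. k \<le> n \<Longrightarrow> ((\<lambda>s. X s k) has_real_derivative X' k) (at t)"
    and gX: "((\<lambda>s. g (X s)) has_real_derivative y) (at t)"
    and nz: "partial_deriv (integrand_domain n a b) (n + 1) g (X t) \<noteq> 0"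
  shows "((\<lambda>s. X s (n + 1)) has_real_derivative
           (y - (\<Sum>k\<le>n. partial_deriv (integrand_domain n a b) k g (X t) * X' k))
             / partial_deriv (integrand_domain n a b) (n + 1) g (X t)) (at t)"
proof -
  define D where "D = integrand_domain n a b"
  obtain c where c: "\<And>k. k < n + 2 \<Longrightarrow> ((\<lambda>s. c s k) \<longlongrightarrow> partial_deriv D k g (X t)) (at t)"
    "\<forall>\<^sub>F s in at t. g (X s) - g (X t) = (\<Sum>k<n + 2. c s k * (X s k - X t k))"
    using increment_as_sum[OF g XD(2,1) X] unfolding D_def by blast
  have "\<forall>\<^sub>F s in at t. c s (n + 1) \<noteq> 0"
    using tendsto_imp_eventually_ne[OF c(1)[of "n + 1"]] nz by (simp add: D_def)
  with c(2) have ev: "\<forall>\<^sub>F s in at t.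
      ((g (X s) - g (X t)) / (s - t) - (\<Sum>k\<le>n. c s k * ((X s k - X t k) / (s - t)))) / c s (n + 1)
        = (X s (n + 1) - X t (n + 1)) / (s - t)"
  proof eventually_elim
    case (elim s)
    have "(\<Sum>k<n + 2. c s k * (X s k - X t k))
        = (\<Sum>k\<le>n. c s k * (X s k - X t k)) + c s (n + 1) * (X s (n + 1) - X t (n + 1))"
      by (simp flip: lessThan_Suc_atMost)
    with elim show ?case
      by (simp add: diff_divide_distrib[symmetric] sum_divide_distrib[symmetric])
  qed
  have "((\<lambda>s. ((g (X s) - g (X t)) / (s - t) - (\<Sum>k\<le>n. c s k * ((X s k - X t k) / (s - t)))) / c s (n + 1))
      \<longlongrightarrow> (y - (\<Sum>k\<le>n. partial_deriv D k g (X t) * X' k)) / partial_deriv D (n + 1) g (X t)) (at t)"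
    using gX X' nz by (intro tendsto_intros c) (auto simp: has_field_derivative_iff D_def)
  then show ?thesis
    unfolding has_field_derivative_iff D_def[symmetric] using ev by (rule Lim_transform_eventually)
qed

section \<open>The lemma of du Bois-Reymond for higher order\<close>

text \<open>
  A function is carried along with its derivatives as a sequence \<open>H\<close>. Differentiating is then a
  shift of the sequence and integrating prepends a term, while \<^const>\<open>nth_deriv_on\<close> would
  have to be evaluated again each time.
\<close>

definition derivative_chain :: "nat \<Rightarrow> real set \<Rightarrow> (nat \<Rightarrow> real \<Rightarrow> real) \<Rightarrow> bool" where
  "derivative_chain m S H \<longleftrightarrow>
     (\<forall>k<m. \<forall>t\<in>S. (H k has_real_derivative H (Suc k) t) (at t within S)) \<and> continuous_on S (H m)"

lemma derivative_chain_continuous_on: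
  assumes "derivative_chain m S H" and "k \<le> m"
  shows "continuous_on S (H k)"
  using assms unfolding derivative_chain_def
  by (metis DERIV_continuous_on le_neq_implies_less)

lemma derivative_chain_linear:
  assumes "derivative_chain m S H" and "derivative_chain m S G"
  shows "derivative_chain m S (\<lambda>k t. H k t + c * G k t)"
  using assms unfolding derivative_chain_def
  by (auto intro!: DERIV_add DERIV_cmult continuous_intros)

text \<open>
  The derivative of top order has to vanish at the ends as well, since a boundary condition may
  prescribe it.
\<close>

definition test_chain :: "real \<Rightarrow> real \<Rightarrow> nat \<Rightarrow> (nat \<Rightarrow> real \<Rightarrow> real) \<Rightarrow> bool" where
  "test_chain a b m H \<longleftrightarrow> derivative_chain m {a..b} H \<and> (\<forall>k\<le>m. H k a = 0 \<and> H k b = 0)"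

text \<open>
  The Euler-Lagrange equation in weak form, with coefficients \<open>\<phi>\<close>. It is imposed through test
  functions because the coefficients need not be differentiable, so that the classical equation,
  in which \<open>\<phi> k\<close> is differentiated \<open>k\<close> times, has no meaning yet.
\<close>

definition annihilates_tests :: "real \<Rightarrow> real \<Rightarrow> nat \<Rightarrow> (nat \<Rightarrow> real \<Rightarrow> real) \<Rightarrow> bool" where
  "annihilates_tests a b m \<phi> \<longleftrightarrow> (\<forall>k\<le>m. continuous_on {a..b} (\<phi> k)) \<and>
     (\<forall>H. test_chain a b m H \<longrightarrow> integral {a..b} (\<lambda>t. \<Sum>k\<le>m. \<phi> k t * H k t) = 0)"

text \<open>
  The fundamental lemma of the calculus of variations. Testing with \<open>(t - a) (b - t) \<phi>\<close> makes the
  integrand a nonnegative function that vanishes inside \<open>{a..b}\<close> only where \<open>\<phi>\<close> does; the two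
  linear factors supply the boundary values.
\<close>

lemma annihilates_tests_0:
  assumes ab: "a < b" and \<phi>: "annihilates_tests a b 0 \<phi>" and t: "t \<in> {a<..<b}"
  shows "\<phi> 0 t = 0"
proof -
  have cont: "continuous_on {a..b} (\<phi> 0)"
    using \<phi> by (simp add: annihilates_tests_def)
  define H where "H = (\<lambda>(k::nat) t. (t - a) * (b - t) * \<phi> 0 t)"
  have "test_chain a b 0 H"
    unfolding test_chain_def derivative_chain_def H_def by (auto intro!: continuous_intros cont)
  then have "integral {a..b} (\<lambda>t. \<phi> 0 t * H 0 t) = 0"
    using \<phi> by (simp add: annihilates_tests_def)
  moreover have "continuous_on {a..b} (\<lambda>t. \<phi> 0 t * H 0 t)"
    unfolding H_def by (intro continuous_intros cont)
  moreover have "\<phi> 0 s * H 0 s \<ge> 0" if "s \<in> {a..b}" for s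
  proof -
    have "\<phi> 0 s * H 0 s = (s - a) * (b - s) * (\<phi> 0 s)\<^sup>2"
      by (simp add: H_def power2_eq_square)
    then show ?thesis using that by simp
  qed
  ultimately have "\<phi> 0 t * H 0 t = 0"
    using integral_eq_0_iff[of a b "\<lambda>t. \<phi> 0 t * H 0 t"] ab t by simp
  then show ?thesis using t by (simp add: H_def)
qed

text \<open>
  A test function \<open>G\<close> of order \<open>m\<close> is the derivative of one of order \<open>m + 1\<close> exactly if its
  integral vanishes. For that primitive \<open>H\<close>, integration by parts turns \<open>\<integral> \<phi>\<^sub>0 H\<close> into
  \<open>- \<integral> I G\<close>, where \<open>I\<close> is the primitive of \<open>\<phi>\<^sub>0\<close>, so the lowest coefficient is absorbed in the
  next one.
\<close>

lemma annihilates_mean_zero_tests: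
  assumes ab: "a < b" and \<phi>: "annihilates_tests a b (Suc m) \<phi>"
    and G: "test_chain a b m G" and mean: "integral {a..b} (G 0) = 0"
  shows "integral {a..b}
    (\<lambda>t. \<Sum>k\<le>m. (\<phi> (Suc k) t - (if k = 0 then integral {a..t} (\<phi> 0) else 0)) * G k t) = 0"
proof -
  define H where "H = (\<lambda>k. case k of 0 \<Rightarrow> (\<lambda>t. integral {a..t} (G 0)) | Suc j \<Rightarrow> G j)"
  define I where "I = (\<lambda>t. integral {a..t} (\<phi> 0))"
  have \<phi>c: "continuous_on {a..b} (\<phi> k)" if "k \<le> Suc m" for k
    using \<phi> that by (simp add: annihilates_tests_def)
  have Gc: "continuous_on {a..b} (G k)" if "k \<le> m" for k
    using G that by (auto simp: test_chain_def intro: derivative_chain_continuous_on)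
  have dI: "(I has_real_derivative \<phi> 0 t) (at t within {a..b})" if "t \<in> {a..b}" for t
    unfolding I_def using \<phi>c that by (intro integral_has_real_derivative) auto
  have dH: "(H 0 has_real_derivative G 0 t) (at t within {a..b})" if "t \<in> {a..b}" for t
    unfolding H_def using Gc that by (auto intro: integral_has_real_derivative)
  have Hc: "continuous_on {a..b} (H 0)" and Ic: "continuous_on {a..b} I"
    using DERIV_continuous_on[OF dH] DERIV_continuous_on[OF dI] by auto
  have H: "test_chain a b (Suc m) H"
    unfolding test_chain_def derivative_chain_def
  proof (intro conjI allI impI ballI)
    fix k t assume "k < Suc m" "t \<in> {a..b}"
    then show "(H k has_real_derivative H (Suc k) t) (at t within {a..b})"
      using dH G by (cases k) (auto simp: H_def test_chain_def derivative_chain_def)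
  next
    show "continuous_on {a..b} (H (Suc m))" using Gc by (simp add: H_def)
  next
    fix k assume "k \<le> Suc m"
    then show "H k a = 0" "H k b = 0"
      using G mean by (cases k; simp add: H_def test_chain_def)+
  qed
  define L where "L = (\<lambda>t. \<Sum>k\<le>m. (\<phi> (Suc k) t - (if k = 0 then I t else 0)) * G k t)"
  have "continuous_on {a..b} (\<lambda>t. if k = 0 then I t else 0)" for k :: nat
    using Ic by (cases "k = 0") auto
  then have Lc: "continuous_on {a..b} L"
    unfolding L_def by (intro continuous_intros \<phi>c Gc) auto
  have parts: "((\<lambda>t. \<phi> 0 t * H 0 t + I t * G 0 t) has_integral I b * H 0 b - I a * H 0 a) {a..b}"
    using ab dI dH
    by (intro fundamental_theorem_of_calculus)
       (auto simp flip: has_real_derivative_iff_has_vector_derivative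
             intro!: derivative_eq_intros simp: algebra_simps)
  have "(\<Sum>k\<le>Suc m. \<phi> k t * H k t) = (\<phi> 0 t * H 0 t + I t * G 0 t) + L t" for t
  proof -
    have "L t = (\<Sum>k\<le>m. \<phi> (Suc k) t * G k t - (if k = 0 then I t * G 0 t else 0))"
      unfolding L_def by (intro sum.cong) (auto simp: algebra_simps)
    also have "\<dots> = (\<Sum>k\<le>m. \<phi> (Suc k) t * G k t) - I t * G 0 t"
      by (simp add: sum_subtractf)
    finally show ?thesis
      by (simp add: sum.atMost_Suc_shift H_def del: sum.atMost_Suc)
  qed
  moreover have "integral {a..b} (\<lambda>t. \<Sum>k\<le>Suc m. \<phi> k t * H k t) = 0"
    using \<phi> H by (simp add: annihilates_tests_def)
  ultimately have "integral {a..b} (\<lambda>t. (\<phi> 0 t * H 0 t + I t * G 0 t) + L t) = 0"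
    by simp
  moreover have "integral {a..b} (\<lambda>t. (\<phi> 0 t * H 0 t + I t * G 0 t) + L t)
      = integral {a..b} (\<lambda>t. \<phi> 0 t * H 0 t + I t * G 0 t) + integral {a..b} L"
    using parts Lc by (intro integral_add) (auto intro: integrable_continuous_real)
  moreover have "integral {a..b} (\<lambda>t. \<phi> 0 t * H 0 t + I t * G 0 t) = 0"
    using integral_unique[OF parts] mean by (simp add: H_def)
  ultimately have "integral {a..b} L = 0" by simp
  then show ?thesis unfolding L_def I_def .
qed

text \<open>
  A linear functional \<open>L\<close> that vanishes on the kernel of the functional \<open>G \<mapsto> \<integral> G\<close> is a multiple
  of it. The factor \<open>c\<close> is the constant of integration that remains undetermined in \<open>I\<close>; with
  it the restriction to tests of mean zero disappears.
\<close>

lemma annihilates_tests_reduce_order: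
  assumes ab: "a < b" and \<phi>: "annihilates_tests a b (Suc m) \<phi>"
  obtains c where "annihilates_tests a b m
    (\<lambda>k t. \<phi> (Suc k) t - (if k = 0 then integral {a..t} (\<phi> 0) + c else 0))"
proof -
  define I where "I = (\<lambda>t. integral {a..t} (\<phi> 0))"
  define \<psi> where "\<psi> = (\<lambda>k t. \<phi> (Suc k) t - (if k = (0::nat) then I t else 0))"
  define L where "L = (\<lambda>G. integral {a..b} (\<lambda>t. \<Sum>k\<le>m. \<psi> k t * G k t))"
  have \<phi>c: "continuous_on {a..b} (\<phi> k)" if "k \<le> Suc m" for k
    using \<phi> that by (simp add: annihilates_tests_def)
  have Ic: "continuous_on {a..b} I"
    unfolding I_def
    by (rule DERIV_continuous_on, rule integral_has_real_derivative) (use \<phi>c in auto)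
  have \<psi>c: "continuous_on {a..b} (\<psi> k)" if "k \<le> m" for k
    unfolding \<psi>_def using that by (cases "k = 0") (auto intro!: continuous_intros \<phi>c Ic)
  have Gc: "continuous_on {a..b} (G k)" if "test_chain a b m G" "k \<le> m" for k G
    using that by (auto simp: test_chain_def intro: derivative_chain_continuous_on)
  have int: "(\<lambda>t. \<Sum>k\<le>m. \<psi> k t * G k t) integrable_on {a..b}" if "test_chain a b m G" for G
    by (intro integrable_continuous_real continuous_intros \<psi>c Gc[OF that]) auto
  have int0: "G 0 integrable_on {a..b}" if "test_chain a b m G" for G
    by (intro integrable_continuous_real Gc[OF that]) auto
  have mean0: "L G = 0" if "test_chain a b m G" "integral {a..b} (G 0) = 0" for G
    using annihilates_mean_zero_tests[OF ab \<phi> that] unfolding L_def \<psi>_def I_def .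
  have "\<exists>c. \<forall>G. test_chain a b m G \<longrightarrow> L G = c * integral {a..b} (G 0)"
  proof (cases "\<exists>K. test_chain a b m K \<and> integral {a..b} (K 0) \<noteq> 0")
    case False
    then show ?thesis using mean0 by (intro exI[of _ 0]) auto
  next
    case True
    then obtain K where K: "test_chain a b m K" and \<mu>: "integral {a..b} (K 0) \<noteq> 0" by blast
    have "L G = L K / integral {a..b} (K 0) * integral {a..b} (G 0)" if G: "test_chain a b m G" for G
    proof -
      \<comment> \<open>The combination \<open>G + r K\<close> has integral zero.\<close>
      define r where "r = - (integral {a..b} (G 0) / integral {a..b} (K 0))"
      define M where "M = (\<lambda>k t. G k t + r * K k t)"
      have M: "test_chain a b m M"
        using G K unfolding test_chain_def M_def by (auto intro: derivative_chain_linear)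
      have "integral {a..b} (M 0) = integral {a..b} (G 0) + r * integral {a..b} (K 0)"
        unfolding M_def using int0[OF G] int0[OF K]
        by (subst integral_add) (auto intro: integrable_on_mult_right)
      then have "integral {a..b} (M 0) = 0" using \<mu> by (simp add: r_def)
      then have "L M = 0" using mean0[OF M] by simp
      moreover have "L M = L G + r * L K"
      proof -
        have "L M = integral {a..b} (\<lambda>t. (\<Sum>k\<le>m. \<psi> k t * G k t) + r * (\<Sum>k\<le>m. \<psi> k t * K k t))"
          unfolding L_def M_def by (simp only: distrib_left sum.distrib sum_distrib_left mult.left_commute)
        also have "\<dots> = L G + r * L K"
          unfolding L_def using int[OF G] int[OF K]
          by (subst integral_add) (auto intro: integrable_on_mult_right)
        finally show ?thesis .
      qed
      ultimately show ?thesis by (simp add: r_def)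
    qed
    then show ?thesis by blast
  qed
  then obtain c where c: "\<And>G. test_chain a b m G \<Longrightarrow> L G = c * integral {a..b} (G 0)" by blast
  have "annihilates_tests a b m (\<lambda>k t. \<psi> k t - (if k = 0 then c else 0))"
    unfolding annihilates_tests_def
  proof (intro conjI allI impI)
    fix k assume "k \<le> m"
    then show "continuous_on {a..b} (\<lambda>t. \<psi> k t - (if k = 0 then c else 0))"
      by (intro continuous_intros \<psi>c)
  next
    fix G assume G: "test_chain a b m G"
    have "(\<Sum>k\<le>m. (\<psi> k t - (if k = 0 then c else 0)) * G k t) = (\<Sum>k\<le>m. \<psi> k t * G k t) - c * G 0 t" for t
    proof -
      have "(\<Sum>k\<le>m. (\<psi> k t - (if k = 0 then c else 0)) * G k t)
          = (\<Sum>k\<le>m. \<psi> k t * G k t - (if k = 0 then c * G 0 t else 0))"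
        by (intro sum.cong) (auto simp: algebra_simps)
      then show ?thesis by (simp add: sum_subtractf)
    qed
    then have "integral {a..b} (\<lambda>t. \<Sum>k\<le>m. (\<psi> k t - (if k = 0 then c else 0)) * G k t)
        = L G - c * integral {a..b} (G 0)"
      using int[OF G] int0[OF G]
      by (simp add: L_def integral_diff integrable_on_mult_right)
    then show "integral {a..b} (\<lambda>t. \<Sum>k\<le>m. (\<psi> k t - (if k = 0 then c else 0)) * G k t) = 0"
      using c[OF G] by simp
  qed
  also have "(\<lambda>k t. \<psi> k t - (if k = 0 then c else 0))
      = (\<lambda>k t. \<phi> (Suc k) t - (if k = 0 then integral {a..t} (\<phi> 0) + c else 0))"
    by (auto simp: \<psi>_def I_def fun_eq_iff)
  finally show ?thesis by (rule that)
qed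

text \<open>
  Lowering the order one step at a time changes only the coefficient of lowest order. As long as
  the order stays positive the top coefficient is therefore untouched, and in the last step the
  fundamental lemma identifies it with a primitive of a continuous function.
\<close>

lemma du_Bois_Reymond:
  assumes ab: "a < b" and "annihilates_tests a b (Suc m) \<phi>"
  shows "\<exists>\<phi>'. continuous_on {a<..<b} \<phi>' \<and>
           (\<forall>t\<in>{a<..<b}. (\<phi> (Suc m) has_real_derivative \<phi>' t) (at t))"
  using assms(2)
proof (induction m arbitrary: \<phi>)
  case 0
  obtain c where c: "annihilates_tests a b 0
      (\<lambda>k t. \<phi> (Suc k) t - (if k = 0 then integral {a..t} (\<phi> 0) + c else 0))"
    using annihilates_tests_reduce_order[OF ab 0] .
  have eq: "\<phi> 1 t = integral {a..t} (\<phi> 0) + c" if "t \<in> {a<..<b}" for t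
    using annihilates_tests_0[OF ab c that] by simp
  have cont: "continuous_on {a..b} (\<phi> 0)"
    using 0 by (simp add: annihilates_tests_def)
  have "(\<phi> 1 has_real_derivative \<phi> 0 t) (at t)" if t: "t \<in> {a<..<b}" for t
  proof -
    have "((\<lambda>t. integral {a..t} (\<phi> 0)) has_real_derivative \<phi> 0 t) (at t)"
      using integral_has_real_derivative[OF cont, of t] t
      by (simp add: at_within_Icc_at)
    then have "((\<lambda>t. integral {a..t} (\<phi> 0) + c) has_real_derivative \<phi> 0 t) (at t)"
      by (auto intro!: derivative_eq_intros)
    then show ?thesis
      by (rule has_field_derivative_transform_within_open[of _ _ _ "{a<..<b}"]) (use t eq in auto)
  qed
  then show ?case
    using continuous_on_subset[OF cont greaterThanLessThan_subseteq_atLeastAtMost_iff[THEN iffD2]]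
    by (intro exI[of _ "\<phi> 0"]) auto
next
  case (Suc m)
  obtain c where c: "annihilates_tests a b (Suc m)
      (\<lambda>k t. \<phi> (Suc k) t - (if k = 0 then integral {a..t} (\<phi> 0) + c else 0))"
    using annihilates_tests_reduce_order[OF ab Suc.prems] .
  show ?case using Suc.IH[OF c] by simp
qed

section \<open>Derivatives and jets\<close>

lemma nth_deriv_on_derivative_chain:
  assumes H: "derivative_chain m S H" and S: "\<And>t. t \<in> S \<Longrightarrow> at t within S \<noteq> bot"
    and "k \<le> m" and "t \<in> S"
  shows "nth_deriv_on S k (H 0) t = H k t"
  using assms(3,4)
proof (induction k arbitrary: t)
  case (Suc k)
  have "(H k has_vector_derivative H (Suc k) t) (at t within S)"
    using H Suc.prems by (simp add: derivative_chain_def flip: has_real_derivative_iff_has_vector_derivative)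
  then have "(nth_deriv_on S k (H 0) has_vector_derivative H (Suc k) t) (at t within S)"
    by (rule has_vector_derivative_transform[rotated 2]) (use Suc in auto)
  then show ?case
    using vector_derivative_within[OF S[OF Suc.prems(2)]] by simp
qed simp

lemma C_space_derivative_chain:
  assumes H: "derivative_chain m S H" and S: "\<And>t. t \<in> S \<Longrightarrow> at t within S \<noteq> bot"
  shows "H 0 \<in> C_space m S"
proof -
  note eq = nth_deriv_on_derivative_chain[OF assms]
  have "nth_deriv_on S k (H 0) differentiable_on S" if "k < m" for k
    unfolding differentiable_on_def
  proof
    fix t assume t: "t \<in> S"
    have "H k differentiable (at t within S)"
      using H t that by (auto simp: derivative_chain_def real_differentiable_def)
    then show "nth_deriv_on S k (H 0) differentiable (at t within S)"
      using t that eq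
      by (metis differentiable_transform_within less_imp_le_nat zero_less_one)
  qed
  moreover have "continuous_on S (nth_deriv_on S m (H 0))"
    using H eq unfolding derivative_chain_def by (metis (no_types, lifting) continuous_on_cong order_refl)
  ultimately show ?thesis by (simp add: C_space_def)
qed

lemma derivative_chain_nth_deriv_on:
  assumes "u \<in> C_space m S"
  shows "derivative_chain m S (\<lambda>k. nth_deriv_on S k u)"
  using assms
  by (auto simp: C_space_def derivative_chain_def has_real_derivative_iff_has_vector_derivative
      differentiable_on_def vector_derivative_works[symmetric])

lemma at_within_Icc_neq_bot:
  fixes a b :: real
  assumes "a < b" and "t \<in> {a..b}"
  shows "at t within {a..b} \<noteq> bot"
  using assms islimpt_Icc[of a b t] by (simp add: trivial_limit_within)

lemma jet_derivative_chain:
  assumes "a < b" and "derivative_chain n {a..b} H" and "t \<in> {a..b}"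
  shows "jet n a b (H 0) t = (\<lambda>k. if k = 0 then t else if k \<le> n + 1 then H (k - 1) t else 0)"
  using nth_deriv_on_derivative_chain[OF assms(2) at_within_Icc_neq_bot[OF assms(1)] _ assms(3)]
  by (auto simp: jet_def fun_eq_iff)

lemma jet_in_integrand_domain: "t \<in> {a..b} \<Longrightarrow> jet n a b u t \<in> integrand_domain n a b"
  by (auto simp: integrand_domain_iff jet_def)

lemma continuous_on_jet:
  assumes "u \<in> C_space n {a..b}"
  shows "continuous_on {a..b} (jet n a b u)"
proof (rule continuous_on_coordinatewise_then_product)
  fix k
  show "continuous_on {a..b} (\<lambda>t. jet n a b u t k)"
    using derivative_chain_continuous_on[OF derivative_chain_nth_deriv_on[OF assms], of "k - 1"]
    unfolding jet_def by (cases "k = 0"; cases "k \<le> n + 1") (auto intro: continuous_intros)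
qed

section \<open>The first variation\<close>

lemma C_norm_scale_le:
  assumes ab: "a < b" and H: "derivative_chain n {a..b} H"
  obtains B where "B \<ge> 0" "\<And>s. C_norm n a b (\<lambda>t. s * H 0 t) \<le> \<bar>s\<bar> * B"
proof -
  have "\<exists>M\<ge>0. \<forall>t\<in>{a..b}. \<bar>H k t\<bar> \<le> M" if "k \<le> n" for k
  proof -
    have "bounded (H k ` {a..b})"
      by (intro compact_imp_bounded compact_continuous_image derivative_chain_continuous_on[OF H that]) auto
    then show ?thesis
      by (auto simp: bounded_pos intro: less_imp_le)
  qed
  then obtain M where M: "\<And>k. k \<le> n \<Longrightarrow> M k \<ge> 0 \<and> (\<forall>t\<in>{a..b}. \<bar>H k t\<bar> \<le> M k)"
    by metis
  show ?thesis
  proof (rule that[of "\<Sum>k\<le>n. M k"])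
    show "(\<Sum>k\<le>n. M k) \<ge> 0" using M by (intro sum_nonneg) auto
    fix s
    have sH: "derivative_chain n {a..b} (\<lambda>k t. s * H k t)"
      using H unfolding derivative_chain_def by (auto intro!: DERIV_cmult continuous_intros)
    have "(SUP t\<in>{a..b}. \<bar>nth_deriv_on {a..b} k (\<lambda>t. s * H 0 t) t\<bar>) \<le> \<bar>s\<bar> * M k" if "k \<le> n" for k
    proof (rule cSUP_least)
      show "{a..b} \<noteq> {}" using ab by simp
      fix t assume "t \<in> {a..b}"
      then show "\<bar>nth_deriv_on {a..b} k (\<lambda>t. s * H 0 t) t\<bar> \<le> \<bar>s\<bar> * M k"
        using nth_deriv_on_derivative_chain[OF sH at_within_Icc_neq_bot[OF ab] that] M[OF that]
        by (auto simp: abs_mult intro: mult_left_mono)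
    qed
    then show "C_norm n a b (\<lambda>t. s * H 0 t) \<le> \<bar>s\<bar> * (\<Sum>k\<le>n. M k)"
      unfolding C_norm_def sum_distrib_left by (intro sum_mono) auto
  qed
qed

text \<open>
  A test function vanishes at both ends together with all derivatives up to order \<open>n\<close>, so the
  perturbed function \<open>u + s h\<close> satisfies the boundary conditions whatever \<open>N\<close> and \<open>N'\<close> are, and
  it is close to \<open>u\<close> for small \<open>s\<close>. Hence \<open>s = 0\<close> is a local extremum of a real function, whose
  derivative is found by differentiating under the integral sign.
\<close>

lemma first_variation_vanishes:
  assumes ab: "a < b" and f: "C1_integrand n a b f"
    and N: "N \<subseteq> {0..n}" and N': "N' \<subseteq> {0..n}"
    and extr: "local_extremum n a b (functional n a b f) (admissible n a b N N' u_bd w_bd) u"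
    and H: "test_chain a b n H"
  shows "integral {a..b}
    (\<lambda>t. \<Sum>k\<le>n. partial_deriv (integrand_domain n a b) (Suc k) f (jet n a b u t) * H k t) = 0"
proof -
  define D where "D = integrand_domain n a b"
  define U where "U = (\<lambda>k. nth_deriv_on {a..b} k u)"
  define v where "v = (\<lambda>s t. u t + s * H 0 t)"
  \<comment> \<open>The jet of \<open>v s\<close> and its derivative in \<open>s\<close>, written down explicitly so that they are jointly
    continuous by inspection.\<close>
  define J where "J = (\<lambda>s t k. if k = 0 then t else if k \<le> n + 1 then U (k - 1) t + s * H (k - 1) t else 0)"
  define J' where "J' = (\<lambda>t k. if k = 0 then 0 else if k \<le> n + 1 then H (k - 1) t else 0)"
  define \<Phi> where "\<Phi> = (\<lambda>s. integral {a..b} (\<lambda>t. f (J s t)))"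
  have u: "u \<in> admissible n a b N N' u_bd w_bd" using extr by (simp add: local_extremum_def)
  then have uC: "u \<in> C_space n {a..b}" by (simp add: admissible_def)
  have U: "derivative_chain n {a..b} U"
    unfolding U_def by (rule derivative_chain_nth_deriv_on[OF uC])
  have Hc: "derivative_chain n {a..b} H" using H by (simp add: test_chain_def)
  have chain: "derivative_chain n {a..b} (\<lambda>k t. U k t + s * H k t)" for s
    by (rule derivative_chain_linear[OF U Hc])
  have v_eq: "v s = (\<lambda>k t. U k t + s * H k t) 0" for s by (simp add: v_def U_def)
  have v_deriv: "nth_deriv_on {a..b} k (v s) t = U k t + s * H k t"
    if "k \<le> n" "t \<in> {a..b}" for s k t
    unfolding v_eq by (rule nth_deriv_on_derivative_chain[OF chain at_within_Icc_neq_bot[OF ab] that])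
  have v_adm: "v s \<in> admissible n a b N N' u_bd w_bd" for s
  proof -
    have "v s \<in> C_space n {a..b}"
      unfolding v_eq by (rule C_space_derivative_chain[OF chain at_within_Icc_neq_bot[OF ab]])
    moreover have "nth_deriv_on {a..b} k (v s) t = nth_deriv_on {a..b} k u t"
      if "k \<le> n" "t = a \<or> t = b" for k t
      using v_deriv[OF that(1), of t s] that ab H by (auto simp: U_def test_chain_def)
    ultimately show ?thesis
      using u N N' unfolding admissible_def by (auto simp: subset_iff)
  qed
  have v_jet: "jet n a b (v s) t = J s t" if "t \<in> {a..b}" for s t
    unfolding v_eq using jet_derivative_chain[OF ab chain that] by (simp add: J_def)
  have \<Phi>_eq: "functional n a b f (v s) = \<Phi> s" for s
    unfolding functional_def \<Phi>_def using v_jet by (intro integral_cong) simp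
  have JD: "J s t \<in> D" if "t \<in> {a..b}" for s t
    unfolding v_jet[OF that, symmetric] D_def by (rule jet_in_integrand_domain[OF that])
  have Jc: "continuous_on (UNIV \<times> {a..b}) (\<lambda>p. J (fst p) (snd p))"
  proof (rule continuous_on_coordinatewise_then_product)
    fix k
    have "continuous_on (UNIV \<times> {a..b}) (\<lambda>p. G k (snd p))"
      if "derivative_chain n {a..b} G" "k \<le> n" for G :: "nat \<Rightarrow> real \<Rightarrow> real" and k
      by (rule continuous_on_compose2[OF derivative_chain_continuous_on[OF that]])
         (auto intro: continuous_intros)
    note snd_c = this[OF U] this[OF Hc]
    show "continuous_on (UNIV \<times> {a..b}) (\<lambda>p. J (fst p) (snd p) k)"
    proof (cases k)
      case (Suc j)
      then show ?thesis
        unfolding J_def by (cases "j \<le> n") (auto intro!: continuous_intros snd_c)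
    qed (auto simp: J_def intro: continuous_intros)
  qed
  have J'c: "continuous_on (UNIV \<times> {a..b}) (\<lambda>p. J' (snd p) k)" for k
  proof -
    have "continuous_on {a..b} (\<lambda>t. J' t k)"
      using derivative_chain_continuous_on[OF Hc, of "k - 1"]
      unfolding J'_def by (cases "k = 0"; cases "k \<le> n + 1") auto
    then show ?thesis
      by (rule continuous_on_compose2) (auto intro: continuous_intros)
  qed
  have "(\<Phi> has_real_derivative
      integral (cbox a b) (\<lambda>t. \<Sum>k<n + 2. partial_deriv D k f (J 0 t) * J' t k)) (at 0 within UNIV)"
    unfolding \<Phi>_def box_real(2)[symmetric]
  proof (rule leibniz_rule_field_derivative[where fx = "\<lambda>s t. \<Sum>k<n + 2. partial_deriv D k f (J s t) * J' t k"])
    fix s t assume t: "t \<in> cbox a b"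
    show "((\<lambda>s. f (J s t)) has_real_derivative (\<Sum>k<n + 2. partial_deriv D k f (J s t) * J' t k)) (at s within UNIV)"
      unfolding D_def
    proof (rule has_real_derivative_along_curve[OF f])
      show "J r t \<in> integrand_domain n a b" for r using JD t by (simp add: D_def)
      show "((\<lambda>r. J r t k) has_real_derivative J' t k) (at s)" for k
        unfolding J_def J'_def by (auto intro!: derivative_eq_intros)
    qed
  next
    fix s
    have "continuous_on {a..b} (\<lambda>t. f (J s t))"
    proof (rule continuous_on_compose2[OF C1_integrand_continuous_on[OF f]])
      have "continuous_on {a..b} (\<lambda>t. J (fst (s, t)) (snd (s, t)))"
        by (rule continuous_on_compose2[OF Jc]) (auto intro!: continuous_on_Pair continuous_intros)
      then show "continuous_on {a..b} (J s)" by simp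
    qed (use JD in \<open>auto simp: D_def\<close>)
    then show "(\<lambda>t. f (J s t)) integrable_on cbox a b"
      by (simp add: integrable_continuous_real)
  next
    have "continuous_on (UNIV \<times> {a..b}) (\<lambda>p. partial_deriv D k f (J (fst p) (snd p)))"
      if "k < n + 2" for k
    proof (rule continuous_on_compose2[OF _ Jc])
      show "continuous_on D (partial_deriv D k f)" using f that by (simp add: C1_integrand_def D_def)
    qed (use JD in auto)
    then have "continuous_on (UNIV \<times> {a..b})
        (\<lambda>p. \<Sum>k<n + 2. partial_deriv D k f (J (fst p) (snd p)) * J' (snd p) k)"
      by (intro continuous_intros J'c) auto
    then show "continuous_on (UNIV \<times> cbox a b) (\<lambda>(s, t). \<Sum>k<n + 2. partial_deriv D k f (J s t) * J' t k)"
      by (simp add: case_prod_unfold del: sum.lessThan_Suc)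
  qed auto
  moreover have "(\<Sum>k<n + 2. partial_deriv D k f (J 0 t) * J' t k)
      = (\<Sum>k\<le>n. partial_deriv D (Suc k) f (J 0 t) * H k t)" for t
    unfolding add_2_eq_Suc'
    by (subst sum.lessThan_Suc_shift) (simp add: J'_def lessThan_Suc_atMost del: sum.lessThan_Suc)
  ultimately have der: "(\<Phi> has_real_derivative
      integral {a..b} (\<lambda>t. \<Sum>k\<le>n. partial_deriv D (Suc k) f (J 0 t) * H k t)) (at 0)"
    by (simp only: box_real(2))
  \<comment> \<open>The summand 1 in the denominator of \<open>\<epsilon> / (B + 1)\<close> keeps the radius meaningful for \<open>B = 0\<close>.\<close>
  obtain B where B: "B \<ge> 0" "\<And>s. C_norm n a b (\<lambda>t. s * H 0 t) \<le> \<bar>s\<bar> * B"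
    using C_norm_scale_le[OF ab Hc] by blast
  have close: "C_norm n a b (\<lambda>t. v s t - u t) < \<epsilon>" if "\<bar>0 - s\<bar> < \<epsilon> / (B + 1)" for s \<epsilon>
  proof -
    have "C_norm n a b (\<lambda>t. v s t - u t) \<le> \<bar>s\<bar> * B" using B(2) by (simp add: v_def)
    also have "\<dots> \<le> \<bar>s\<bar> * (B + 1)" by (simp add: mult_left_mono)
    also have "\<dots> < \<epsilon>" using that B(1) by (simp add: pos_less_divide_eq)
    finally show ?thesis .
  qed
  have u_v: "u = v 0" by (simp add: v_def)
  obtain \<epsilon> where "\<epsilon> > 0" and \<epsilon>:
    "(\<forall>w\<in>admissible n a b N N' u_bd w_bd. C_norm n a b (\<lambda>t. w t - u t) < \<epsilon> \<longrightarrow>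
        functional n a b f w \<ge> functional n a b f u)
     \<or> (\<forall>w\<in>admissible n a b N N' u_bd w_bd. C_norm n a b (\<lambda>t. w t - u t) < \<epsilon> \<longrightarrow>
        functional n a b f w \<le> functional n a b f u)"
    using extr unfolding local_extremum_def by blast
  have \<delta>: "\<epsilon> / (B + 1) > 0" using \<open>\<epsilon> > 0\<close> B(1) by simp
  have Fu: "functional n a b f u = \<Phi> 0" using \<Phi>_eq[of 0] u_v by simp
  have "integral {a..b} (\<lambda>t. \<Sum>k\<le>n. partial_deriv D (Suc k) f (J 0 t) * H k t) = 0"
    using \<epsilon>
  proof
    assume "\<forall>w\<in>admissible n a b N N' u_bd w_bd. C_norm n a b (\<lambda>t. w t - u t) < \<epsilon> \<longrightarrow>
        functional n a b f w \<ge> functional n a b f u"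
    then have "\<forall>s. \<bar>0 - s\<bar> < \<epsilon> / (B + 1) \<longrightarrow> \<Phi> 0 \<le> \<Phi> s"
      using v_adm close by (metis Fu \<Phi>_eq)
    then show ?thesis by (rule DERIV_local_min[OF der \<delta>])
  next
    assume "\<forall>w\<in>admissible n a b N N' u_bd w_bd. C_norm n a b (\<lambda>t. w t - u t) < \<epsilon> \<longrightarrow>
        functional n a b f w \<le> functional n a b f u"
    then have "\<forall>s. \<bar>0 - s\<bar> < \<epsilon> / (B + 1) \<longrightarrow> \<Phi> s \<le> \<Phi> 0"
      using v_adm close by (metis Fu \<Phi>_eq)
    then show ?thesis by (rule DERIV_local_max[OF der \<delta>])
  qed
  moreover have "jet n a b u t = J 0 t" if "t \<in> {a..b}" for t
    using v_jet[OF that, of 0] u_v by simp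
  then have "integral {a..b} (\<lambda>t. \<Sum>k\<le>n. partial_deriv D (Suc k) f (jet n a b u t) * H k t)
      = integral {a..b} (\<lambda>t. \<Sum>k\<le>n. partial_deriv D (Suc k) f (J 0 t) * H k t)"
    by (intro integral_cong) simp
  ultimately show ?thesis by (simp add: D_def)
qed

text \<open>
  This is the gain of regularity: a priori the composite with the jet is merely continuous, like
  the \<open>n\<close>-th derivative of \<open>u\<close>.
\<close>

lemma highest_partial_has_continuous_derivative:
  assumes n: "n \<ge> 1" and ab: "a < b" and f: "C1_integrand n a b f"
    and "N \<subseteq> {0..n}" and "N' \<subseteq> {0..n}"
    and extr: "local_extremum n a b (functional n a b f) (admissible n a b N N' u_bd w_bd) u"
  obtains \<phi>' where "continuous_on {a<..<b} \<phi>'"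
    "\<And>t. t \<in> {a<..<b} \<Longrightarrow> ((\<lambda>s. partial_deriv (integrand_domain n a b) (n + 1) f (jet n a b u s))
         has_real_derivative \<phi>' t) (at t)"
proof -
  define \<phi> where "\<phi> = (\<lambda>k t. partial_deriv (integrand_domain n a b) (Suc k) f (jet n a b u t))"
  have uC: "u \<in> C_space n {a..b}" using extr by (simp add: local_extremum_def admissible_def)
  have "annihilates_tests a b n \<phi>"
    unfolding annihilates_tests_def
  proof (intro conjI allI impI)
    fix k assume "k \<le> n"
    then have "continuous_on (integrand_domain n a b) (partial_deriv (integrand_domain n a b) (Suc k) f)"
      using f by (simp add: C1_integrand_def)
    then show "continuous_on {a..b} (\<phi> k)"
      unfolding \<phi>_def
      by (rule continuous_on_compose2[OF _ continuous_on_jet[OF uC]]) (auto intro: jet_in_integrand_domain)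
  qed (use first_variation_vanishes[OF ab f assms(4,5) extr] in \<open>simp add: \<phi>_def\<close>)
  then show ?thesis
    using du_Bois_Reymond[OF ab, of "n - 1" \<phi>] n that by (auto simp: \<phi>_def)
qed

section \<open>Regularity of extremals\<close>

theorem theorem2p5:
  fixes n :: nat and a b t\<^sub>0 :: real
    and N N' :: "nat set" and u_bd w_bd :: "nat \<Rightarrow> real"
    and f :: "(nat \<Rightarrow> real) \<Rightarrow> real" and u\<^sub>0 :: "real \<Rightarrow> real"
  assumes "n \<ge> 1" and "a < b"
    and "N \<subseteq> {0..n}" and "N' \<subseteq> {0..n}"
    and "continuous_second_partials (n + 2) (integrand_domain n a b) f"
    and "u\<^sub>0 \<in> admissible n a b N N' u_bd w_bd"
    and "local_extremum n a b (functional n a b f) (admissible n a b N N' u_bd w_bd) u\<^sub>0"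
    and "t\<^sub>0 \<in> {a<..<b}"
    and "partial_deriv (integrand_domain n a b) (n + 1)
           (partial_deriv (integrand_domain n a b) (n + 1) f) (jet n a b u\<^sub>0 t\<^sub>0) \<noteq> 0"
  shows "\<exists>\<delta>>0. {t\<^sub>0 - \<delta><..<t\<^sub>0 + \<delta>} \<subseteq> {a..b} \<and> u\<^sub>0 \<in> C_space (n + 1) {t\<^sub>0 - \<delta><..<t\<^sub>0 + \<delta>}"
proof -
  note n = assms(1) and ab = assms(2) and f2 = assms(5)
  define D where "D = integrand_domain n a b"
  define g where "g = partial_deriv D (n + 1) f"
  define U where "U = (\<lambda>k. nth_deriv_on {a..b} k u\<^sub>0)"
  define J where "J = jet n a b u\<^sub>0"
  have pC1: "C1_integrand n a b (partial_deriv D i f)" if "i < n + 2" for i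
    using f2 that by (simp add: continuous_second_partials_def C1_integrand_def D_def)
  have f: "C1_integrand n a b f"
    using f2 C1_integrand_continuous_on[OF pC1]
    by (simp add: continuous_second_partials_def C1_integrand_def D_def)
  have g: "C1_integrand n a b g" unfolding g_def by (rule pC1) simp
  have uC: "u\<^sub>0 \<in> C_space n {a..b}" using assms(6) by (simp add: admissible_def)
  have U: "derivative_chain n {a..b} U"
    unfolding U_def by (rule derivative_chain_nth_deriv_on[OF uC])
  have U0: "U 0 = u\<^sub>0" by (simp add: U_def)
  have dU: "(U k has_real_derivative U (Suc k) t) (at t)" if "k < n" "t \<in> {a<..<b}" for k t
    using U that by (auto simp: derivative_chain_def at_within_Icc_at[symmetric])
  have JD: "J t \<in> D" if "t \<in> {a..b}" for t
    unfolding J_def D_def by (rule jet_in_integrand_domain[OF that])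
  have "continuous_on {a..b} J" unfolding J_def by (rule continuous_on_jet[OF uC])
  then have Jc: "continuous_on {a<..<b} J" by (rule continuous_on_subset) auto
  have Jsub: "J ` {a<..<b} \<subseteq> D" using JD by auto
  obtain \<phi>' where \<phi>': "continuous_on {a<..<b} \<phi>'"
      "\<And>t. t \<in> {a<..<b} \<Longrightarrow> ((\<lambda>s. g (J s)) has_real_derivative \<phi>' t) (at t)"
    using highest_partial_has_continuous_derivative[OF n ab f assms(3,4,7)]
    unfolding g_def J_def D_def by blast
  have Qc: "continuous_on {a<..<b} (\<lambda>t. partial_deriv D k g (J t))" if "k < n + 2" for k
    using g that
    by (intro continuous_on_compose2[OF _ Jc Jsub]) (simp add: C1_integrand_def D_def)
  \<comment> \<open>What differentiating \<open>g (J t)\<close> by the chain rule and solving for the derivative of the last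
    coordinate yields; coordinate 0 of the jet is \<open>t\<close> itself and has derivative 1.\<close>
  define V where "V = (\<lambda>t. (\<phi>' t - (\<Sum>k\<le>n. partial_deriv D k g (J t) * (if k = 0 then 1 else U k t)))
                          / partial_deriv D (n + 1) g (J t))"
  have dUn: "(U n has_real_derivative V t) (at t)"
    if t: "t \<in> {a<..<b}" and nz: "partial_deriv D (n + 1) g (J t) \<noteq> 0" for t
  proof -
    have "((\<lambda>s. J s (n + 1)) has_real_derivative V t) (at t)"
      unfolding V_def D_def
    proof (rule has_real_derivative_last_coordinate[OF g])
      show "\<forall>\<^sub>F s in at t. J s \<in> integrand_domain n a b"
        using eventually_at_in_open'[of "{a<..<b}" t] t JD
        by (auto simp: D_def elim!: eventually_mono)
      show "J t \<in> integrand_domain n a b" using JD t by (simp add: D_def)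
      show "(J \<longlongrightarrow> J t) (at t)"
        using Jc t by (simp add: continuous_on_eq_continuous_at isCont_def)
      show "((\<lambda>s. g (J s)) has_real_derivative \<phi>' t) (at t)" by (rule \<phi>'(2)[OF t])
      show "partial_deriv (integrand_domain n a b) (n + 1) g (J t) \<noteq> 0" using nz by (simp add: D_def)
      fix k assume "k \<le> n"
      then show "((\<lambda>s. J s k) has_real_derivative (if k = 0 then 1 else U k t)) (at t)"
        using dU[of "k - 1" t] t by (cases k) (auto simp: J_def jet_def U_def)
    qed
    then show ?thesis by (simp add: J_def jet_def U_def)
  qed
  define W where "W = {t \<in> {a<..<b}. partial_deriv D (n + 1) g (J t) \<noteq> 0}"
  have "open W"
    using continuous_open_preimage[OF Qc[of "n + 1"], of "- {0}"]
    by (simp add: W_def vimage_def Int_def open_Compl)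
  moreover have "t\<^sub>0 \<in> W" using assms(8,9) by (simp add: W_def D_def g_def J_def)
  ultimately obtain \<delta> where "\<delta> > 0" "ball t\<^sub>0 \<delta> \<subseteq> W" by (rule openE)
  define S where "S = {t\<^sub>0 - \<delta><..<t\<^sub>0 + \<delta>}"
  have SW: "S \<subseteq> W" using \<open>ball t\<^sub>0 \<delta> \<subseteq> W\<close> by (simp add: S_def ball_eq_greaterThanLessThan)
  then have Sab: "S \<subseteq> {a<..<b}" by (auto simp: W_def)
  have "open S" by (simp add: S_def)
  define H where "H = (\<lambda>k. if k \<le> n then U k else V)"
  have "derivative_chain (n + 1) S H"
    unfolding derivative_chain_def
  proof (intro conjI allI impI ballI)
    fix k t assume k: "k < n + 1" and t: "t \<in> S"
    have "(H k has_real_derivative H (Suc k) t) (at t)"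
      using dU[of k t] dUn[of t] k t SW by (cases "k = n") (auto simp: H_def W_def)
    then show "(H k has_real_derivative H (Suc k) t) (at t within S)"
      by (rule has_field_derivative_at_within)
  next
    have Uc: "continuous_on S (U k)" if "k \<le> n" for k
      by (rule continuous_on_subset[OF derivative_chain_continuous_on[OF U that]]) (use Sab in auto)
    have "continuous_on S (\<lambda>t. if k = 0 then 1 else U k t)" if "k \<le> n" for k
      using Uc[OF that] by (cases "k = 0") (auto intro: continuous_intros)
    then have "continuous_on S V"
      unfolding V_def using SW
      by (intro continuous_intros continuous_on_subset[OF Qc Sab] continuous_on_subset[OF \<phi>'(1) Sab])
         (auto simp: W_def)
    then show "continuous_on S (H (n + 1))" by (simp add: H_def)
  qed
  then have "H 0 \<in> C_space (n + 1) S"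
    by (rule C_space_derivative_chain) (simp add: at_within_open[OF _ \<open>open S\<close>])
  then have "u\<^sub>0 \<in> C_space (n + 1) S" by (simp add: H_def U0)
  moreover have "S \<subseteq> {a..b}" using Sab by auto
  ultimately show ?thesis using \<open>\<delta> > 0\<close> unfolding S_def by blast
qed

end
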